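(* Let $L$ be a nilpotent Lie-Yamaguti algebra of index $2$ with center $\mathcal Z(L)$, let $\overline L=L/\mathcal Z(L)$, and consider the abelian extension $0\to\mathcal Z(L)\xrightarrow{i}L\xrightarrow{p}\overline L\to0$ ($i$ the inclusion, $p$ the projection), with section $s$ of $p$ and induced cocycle $(\alpha,\beta)$. A pair $(\phi,\psi)\in\mathrm{Aut}(\mathcal Z(L))\times\mathrm{Aut}(\overline L)$ is inducible if and only if for all $a,b,c\in\overline L$ $$\phi\circ\alpha(a,b)=\alpha\circ(\psi,\psi)(a,b)\quad\text{and}\quad\phi\circ\beta(a,b,c)=\beta\circ(\psi,\psi,\psi)(a,b,c).$$
   Context: All vector spaces are over a field $\mathbb{K}$ of characteristic zero. A Lie-Yamaguti algebra is a vector space $L$ with a bilinear operation $[\cdot,\cdot]$ and a trilinear operation $\{\cdot,\cdot,\cdot\}$ such that for all $a,b,c,x,y,z$: (LY1) $[a,b]=-[b,a]$; (LY2) $\{a,b,c\}=-\{b,a,c\}$; (LY3) $[[a,b],c]+\{a,b,c\}+[[b,c],a]+\{b,c,a\}+[[c,a],b]+\{c,a,b\}=0$; (LY4) $\{[a,b],c,x\}+\{[b,c],a,x\}+\{[c,a],b,x\}=0$; (LY5) $\{a,b,[x,y]\}=[\{a,b,x\},y]+[x,\{a,b,y\}]$; (LY6) $\{a,b,\{x,y,z\}\}=\{\{a,b,x\},y,z\}+\{x,\{a,b,y\},z\}+\{x,y,\{a,b,z\}\}$. $\mathrm{Aut}$ denotes the group of bijective linear self-maps preserving both operations. The center is $\mathcal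 Z(L)=\{a\in L:[a,x]=0,\ \{a,x,y\}=0=\{x,y,a\}\ \forall x,y\in L\}$. Put $L^{(0)}=L$ and $L^{(n+1)}=[L^{(n)},L]+\{L^{(n)},L,L\}+\{L,L,L^{(n)}\}$ for $n\ge 0$. $L$ is nilpotent of index $k$ if $k$ is the least positive integer with $L^{(k)}=0$. A section of $p$ is a linear map $s:\overline L\to L$ with $p\circ s=\mathrm{id}$. The induced cocycle is $\alpha(a,b)=[s(a),s(b)]-s([a,b])$, $\beta(a,b,c)=\{s(a),s(b),s(c)\}-s(\{a,b,c\})$, with values in $\mathcal Z(L)$. A pair $(\phi,\psi)$ is inducible if there is $\gamma\in\mathrm{Aut}(L)$ with $\gamma(\mathcal Z(L))=\mathcal Z(L)$, $\gamma|_{\mathcal Z(L)}=\phi$ and $p\gamma s=\psi$. *)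

theory Defs
  imports "HOL-Algebra.Module" "HOL-Algebra.QuotRing"
begin

text \<open>
  Vector spaces over \<open>K\<close> are modules over a field \<open>K\<close>. The binary operation \<open>[a, b]\<close> is the
  field \<^const>\<open>mult\<close> of the underlying record, written \<open>a \<otimes> b\<close>; it is not assumed to be associative
  and the field \<^const>\<open>one\<close> plays no role. All maps are relevant on carriers only: their values
  elsewhere are irrelevant.
\<close>

record ('k, 'v) ly_algebra = "('k, 'v) module" +
  triple :: "'v \<Rightarrow> 'v \<Rightarrow> 'v \<Rightarrow> 'v"  (\<open>tri\<index>\<close>)

definition linear_map ::
    "('k, 'm) ring_scheme \<Rightarrow> ('k, 'v, 'n) module_scheme \<Rightarrow> ('k, 'w, 'p) module_scheme
      \<Rightarrow> ('v \<Rightarrow> 'w) \<Rightarrow> bool" where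
  "linear_map K V W f \<longleftrightarrow>
     f \<in> carrier V \<rightarrow> carrier W \<and>
     (\<forall>x\<in>carrier V. \<forall>y\<in>carrier V. f (x \<oplus>\<^bsub>V\<^esub> y) = f x \<oplus>\<^bsub>W\<^esub> f y) \<and>
     (\<forall>k\<in>carrier K. \<forall>x\<in>carrier V. f (k \<odot>\<^bsub>V\<^esub> x) = k \<odot>\<^bsub>W\<^esub> f x)"

locale lie_yamaguti = field K + module K L for K (structure) and L (structure) +
  assumes char_zero: "\<And>n::nat. n > 0 \<Longrightarrow> [n] \<cdot>\<^bsub>K\<^esub> \<one>\<^bsub>K\<^esub> \<noteq> \<zero>\<^bsub>K\<^esub>"
    and mult_linear_left: "b \<in> carrier L \<Longrightarrow> linear_map K L L (\<lambda>a. a \<otimes>\<^bsub>L\<^esub> b)"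
    and mult_linear_right: "a \<in> carrier L \<Longrightarrow> linear_map K L L (\<lambda>b. a \<otimes>\<^bsub>L\<^esub> b)"
    and tri_linear_1: "\<lbrakk>b \<in> carrier L; c \<in> carrier L\<rbrakk> \<Longrightarrow> linear_map K L L (\<lambda>a. tri\<^bsub>L\<^esub> a b c)"
    and tri_linear_2: "\<lbrakk>a \<in> carrier L; c \<in> carrier L\<rbrakk> \<Longrightarrow> linear_map K L L (\<lambda>b. tri\<^bsub>L\<^esub> a b c)"
    and tri_linear_3: "\<lbrakk>a \<in> carrier L; b \<in> carrier L\<rbrakk> \<Longrightarrow> linear_map K L L (\<lambda>c. tri\<^bsub>L\<^esub> a b c)"
    and LY1: "\<lbrakk>a \<in> carrier L; b \<in> carrier L\<rbrakk> \<Longrightarrow> a \<otimes>\<^bsub>L\<^esub> b = \<ominus>\<^bsub>L\<^esub> (b \<otimes>\<^bsub>L\<^esub> a)"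
    and LY2: "\<lbrakk>a \<in> carrier L; b \<in> carrier L; c \<in> carrier L\<rbrakk>
        \<Longrightarrow> tri\<^bsub>L\<^esub> a b c = \<ominus>\<^bsub>L\<^esub> (tri\<^bsub>L\<^esub> b a c)"
    and LY3: "\<lbrakk>a \<in> carrier L; b \<in> carrier L; c \<in> carrier L\<rbrakk>
        \<Longrightarrow> (a \<otimes>\<^bsub>L\<^esub> b) \<otimes>\<^bsub>L\<^esub> c \<oplus>\<^bsub>L\<^esub> tri\<^bsub>L\<^esub> a b c \<oplus>\<^bsub>L\<^esub> (b \<otimes>\<^bsub>L\<^esub> c) \<otimes>\<^bsub>L\<^esub> a \<oplus>\<^bsub>L\<^esub> tri\<^bsub>L\<^esub> b c a
            \<oplus>\<^bsub>L\<^esub> (c \<otimes>\<^bsub>L\<^esub> a) \<otimes>\<^bsub>L\<^esub> b \<oplus>\<^bsub>L\<^esub> tri\<^bsub>L\<^esub> c a b = \<zero>\<^bsub>L\<^esub>"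
    and LY4: "\<lbrakk>a \<in> carrier L; b \<in> carrier L; c \<in> carrier L; x \<in> carrier L\<rbrakk>
        \<Longrightarrow> tri\<^bsub>L\<^esub> (a \<otimes>\<^bsub>L\<^esub> b) c x \<oplus>\<^bsub>L\<^esub> tri\<^bsub>L\<^esub> (b \<otimes>\<^bsub>L\<^esub> c) a x \<oplus>\<^bsub>L\<^esub> tri\<^bsub>L\<^esub> (c \<otimes>\<^bsub>L\<^esub> a) b x = \<zero>\<^bsub>L\<^esub>"
    and LY5: "\<lbrakk>a \<in> carrier L; b \<in> carrier L; x \<in> carrier L; y \<in> carrier L\<rbrakk>
        \<Longrightarrow> tri\<^bsub>L\<^esub> a b (x \<otimes>\<^bsub>L\<^esub> y) = tri\<^bsub>L\<^esub> a b x \<otimes>\<^bsub>L\<^esub> y \<oplus>\<^bsub>L\<^esub> x \<otimes>\<^bsub>L\<^esub> tri\<^bsub>L\<^esub> a b y"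
    and LY6: "\<lbrakk>a \<in> carrier L; b \<in> carrier L; x \<in> carrier L; y \<in> carrier L; z \<in> carrier L\<rbrakk>
        \<Longrightarrow> tri\<^bsub>L\<^esub> a b (tri\<^bsub>L\<^esub> x y z)
          = tri\<^bsub>L\<^esub> (tri\<^bsub>L\<^esub> a b x) y z \<oplus>\<^bsub>L\<^esub> tri\<^bsub>L\<^esub> x (tri\<^bsub>L\<^esub> a b y) z \<oplus>\<^bsub>L\<^esub> tri\<^bsub>L\<^esub> x y (tri\<^bsub>L\<^esub> a b z)"

definition ly_aut ::
    "('k, 'm) ring_scheme \<Rightarrow> ('k, 'v, 'n) ly_algebra_scheme \<Rightarrow> ('v \<Rightarrow> 'v) set" where
  "ly_aut K L = {f. linear_map K L L f \<and> bij_betw f (carrier L) (carrier L) \<and>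
     (\<forall>a\<in>carrier L. \<forall>b\<in>carrier L. f (a \<otimes>\<^bsub>L\<^esub> b) = f a \<otimes>\<^bsub>L\<^esub> f b) \<and>
     (\<forall>a\<in>carrier L. \<forall>b\<in>carrier L. \<forall>c\<in>carrier L.
        f (tri\<^bsub>L\<^esub> a b c) = tri\<^bsub>L\<^esub> (f a) (f b) (f c))}"

definition ly_center :: "('k, 'v, 'n) ly_algebra_scheme \<Rightarrow> 'v set" where
  "ly_center L = {a \<in> carrier L. \<forall>x\<in>carrier L. \<forall>y\<in>carrier L.
     a \<otimes>\<^bsub>L\<^esub> x = \<zero>\<^bsub>L\<^esub> \<and> tri\<^bsub>L\<^esub> a x y = \<zero>\<^bsub>L\<^esub> \<and> tri\<^bsub>L\<^esub> x y a = \<zero>\<^bsub>L\<^esub>}"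

definition ly_center_algebra :: "('k, 'v) ly_algebra \<Rightarrow> ('k, 'v) ly_algebra" where
  "ly_center_algebra L = L\<lparr>carrier := ly_center L\<rparr>"

text \<open>
  The operations on cosets are induced by those on representatives, in the style of
  \<^const>\<open>rcoset_mult\<close> and \<^const>\<open>FactRing\<close>. For \<open>I\<close> an ideal, such as the center, each of the unions
  below is a single coset.
\<close>

definition ly_quot :: "('k, 'v) ly_algebra \<Rightarrow> 'v set \<Rightarrow> ('k, 'v set) ly_algebra" where
  "ly_quot L I =
    \<lparr>carrier = a_rcosets\<^bsub>L\<^esub> I, mult = rcoset_mult L I,
     one = (I +>\<^bsub>L\<^esub> \<one>\<^bsub>L\<^esub>), zero = I, add = set_add L,
     smult = (\<lambda>k A. \<Union>a\<in>A. I +>\<^bsub>L\<^esub> (k \<odot>\<^bsub>L\<^esub> a)),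
     triple = (\<lambda>A B C. \<Union>a\<in>A. \<Union>b\<in>B. \<Union>c\<in>C. I +>\<^bsub>L\<^esub> tri\<^bsub>L\<^esub> a b c)\<rparr>"

definition lin_span ::
    "('k, 'm) ring_scheme \<Rightarrow> ('k, 'v, 'n) module_scheme \<Rightarrow> 'v set \<Rightarrow> 'v set" where
  "lin_span K V S = \<Inter>{U. submodule U K V \<and> S \<subseteq> U}"

primrec ly_series ::
    "('k, 'm) ring_scheme \<Rightarrow> ('k, 'v, 'n) ly_algebra_scheme \<Rightarrow> nat \<Rightarrow> 'v set" where
  "ly_series K L 0 = carrier L"
| "ly_series K L (Suc n) =
     lin_span K L {a \<otimes>\<^bsub>L\<^esub> x | a x. a \<in> ly_series K L n \<and> x \<in> carrier L}
     <+>\<^bsub>L\<^esub> lin_span K L {tri\<^bsub>L\<^esub> a x y | a x y.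
            a \<in> ly_series K L n \<and> x \<in> carrier L \<and> y \<in> carrier L}
     <+>\<^bsub>L\<^esub> lin_span K L {tri\<^bsub>L\<^esub> x y a | x y a.
            x \<in> carrier L \<and> y \<in> carrier L \<and> a \<in> ly_series K L n}"

definition ly_nilpotent_of_index ::
    "('k, 'm) ring_scheme \<Rightarrow> ('k, 'v, 'n) ly_algebra_scheme \<Rightarrow> nat \<Rightarrow> bool" where
  "ly_nilpotent_of_index K L k \<longleftrightarrow>
     k > 0 \<and> ly_series K L k = {\<zero>\<^bsub>L\<^esub>} \<and> (\<forall>j. 0 < j \<and> j < k \<longrightarrow> ly_series K L j \<noteq> {\<zero>\<^bsub>L\<^esub>})"

text \<open>The quotient of \<open>L\<close> by its center and the projection onto it.\<close>

definition ly_bar :: "('k, 'v) ly_algebra \<Rightarrow> ('k, 'v set) ly_algebra" where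
  "ly_bar L = ly_quot L (ly_center L)"

definition ly_proj :: "('k, 'v) ly_algebra \<Rightarrow> 'v \<Rightarrow> 'v set" where
  "ly_proj L a = ly_center L +>\<^bsub>L\<^esub> a"

definition ly_section ::
    "('k, 'm) ring_scheme \<Rightarrow> ('k, 'v) ly_algebra \<Rightarrow> ('v set \<Rightarrow> 'v) \<Rightarrow> bool" where
  "ly_section K L s \<longleftrightarrow>
     linear_map K (ly_bar L) L s \<and> (\<forall>a\<in>carrier (ly_bar L). ly_proj L (s a) = a)"

definition ly_alpha ::
    "('k, 'v) ly_algebra \<Rightarrow> ('v set \<Rightarrow> 'v) \<Rightarrow> 'v set \<Rightarrow> 'v set \<Rightarrow> 'v" where
  "ly_alpha L s a b = (s a \<otimes>\<^bsub>L\<^esub> s b) \<ominus>\<^bsub>L\<^esub> s (a \<otimes>\<^bsub>ly_bar L\<^esub> b)"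

definition ly_beta ::
    "('k, 'v) ly_algebra \<Rightarrow> ('v set \<Rightarrow> 'v) \<Rightarrow> 'v set \<Rightarrow> 'v set \<Rightarrow> 'v set \<Rightarrow> 'v" where
  "ly_beta L s a b c = tri\<^bsub>L\<^esub> (s a) (s b) (s c) \<ominus>\<^bsub>L\<^esub> s (tri\<^bsub>ly_bar L\<^esub> a b c)"

definition ly_inducible ::
    "('k, 'm) ring_scheme \<Rightarrow> ('k, 'v) ly_algebra \<Rightarrow> ('v set \<Rightarrow> 'v)
      \<Rightarrow> ('v \<Rightarrow> 'v) \<Rightarrow> ('v set \<Rightarrow> 'v set) \<Rightarrow> bool" where
  "ly_inducible K L s \<phi> \<psi> \<longleftrightarrow>
     (\<exists>\<gamma>\<in>ly_aut K L. \<gamma> ` ly_center L = ly_center L \<and>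
        (\<forall>z\<in>ly_center L. \<gamma> z = \<phi> z) \<and>
        (\<forall>a\<in>carrier (ly_bar L). ly_proj L (\<gamma> (s a)) = \<psi> a))"

end

theory Submission
  imports Defs
begin

text \<open>
  Let \<open>Z\<close> be the center and \<open>p\<close> the projection of \<open>L\<close> onto \<open>L / Z\<close>. A product vanishes as soon as
  one factor is central, so both operations of \<open>L\<close> depend only on the cosets of their arguments
  (\<open>mult_cong_proj\<close>, \<open>tri_cong_proj\<close>). Nilpotency of index two makes all products
  central (\<open>mult_central\<close>, \<open>tri_central\<close>). The operations of \<open>L / Z\<close> are therefore zero, and the
  cocycle consists of the operations of \<open>L\<close> themselves: \<open>\<alpha>(a, b) = [s a, s b]\<close> and
  \<open>\<beta>(a, b, c) = {s a, s b, s c}\<close>.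

  Now let \<open>\<gamma>\<close> induce \<open>(\<phi>, \<psi>)\<close>. On the central element \<open>[s a, s b]\<close> it acts as \<open>\<phi>\<close>, and \<open>\<gamma> (s a)\<close> lies
  in the same coset as \<open>s (\<psi> a)\<close>; hence \<open>\<phi> [s a, s b] = [\<gamma> (s a), \<gamma> (s b)] = [s (\<psi> a), s (\<psi> b)]\<close>, and
  likewise for the triple product.

  In the other direction, \<open>x = s (p x) + (x - s (p x))\<close> splits \<open>L\<close> as a vector space into the image
  of the section and \<open>Z\<close>, and \<open>\<gamma> x = s (\<psi> (p x)) + \<phi> (x - s (p x))\<close> is the linear bijection acting
  as \<open>\<psi>\<close> on the first summand and as \<open>\<phi>\<close> on the second. Compatibility with the cocycle
  is exactly what makes it multiplicative (\<open>glue_automorphism\<close>).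

  For a general abelian extension by the center, the two sides of the compatibility condition for
  \<open>\<alpha>\<close> may differ by \<open>\<lambda> [a, b]\<close> up to sign, where the linear map \<open>\<lambda>\<close> from \<open>L / Z\<close> to \<open>Z\<close> measures the difference
  between \<open>\<gamma> \<circ> s\<close> and \<open>s \<circ> \<psi>\<close>, and similarly for \<open>\<beta>\<close>; index two makes this term disappear.
\<close>

section \<open>Linear maps\<close>

lemma linear_map_closed: "linear_map K V W f \<Longrightarrow> x \<in> carrier V \<Longrightarrow> f x \<in> carrier W"
  unfolding linear_map_def by blast

lemma linear_map_add:
  "linear_map K V W f \<Longrightarrow> x \<in> carrier V \<Longrightarrow> y \<in> carrier V \<Longrightarrow> f (x \<oplus>\<^bsub>V\<^esub> y) = f x \<oplus>\<^bsub>W\<^esub> f y"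
  unfolding linear_map_def by blast

lemma linear_map_smult:
  "linear_map K V W f \<Longrightarrow> k \<in> carrier K \<Longrightarrow> x \<in> carrier V \<Longrightarrow> f (k \<odot>\<^bsub>V\<^esub> x) = k \<odot>\<^bsub>W\<^esub> f x"
  unfolding linear_map_def by blast

lemma linear_map_compose:
  assumes "linear_map K U V f" "linear_map K V W g"
  shows "linear_map K U W (\<lambda>x. g (f x))"
  using assms unfolding linear_map_def Pi_iff by simp

text \<open>In a group the only idempotent is zero. Speaking of an idempotent of the domain lets the lemma
  apply to the coset operations of the quotient without first making the quotient a module.\<close>

lemma linear_map_idempotent:
  assumes "abelian_group W" "linear_map K V W f" "e \<in> carrier V" "e \<oplus>\<^bsub>V\<^esub> e = e"
  shows "f e = \<zero>\<^bsub>W\<^esub>"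
proof -
  interpret W: abelian_group W by fact
  have "f e \<in> carrier W" using assms(2,3) by (rule linear_map_closed)
  moreover have "f e \<oplus>\<^bsub>W\<^esub> f e = f e" using linear_map_add[OF assms(2,3,3)] assms(4) by simp
  ultimately show ?thesis by (metis W.add.l_cancel_one')
qed

lemma (in module) linear_map_plus:
  assumes f: "linear_map R V M f" and g: "linear_map R V M g"
  shows "linear_map R V M (\<lambda>x. f x \<oplus>\<^bsub>M\<^esub> g x)"
  unfolding linear_map_def Pi_iff
  using linear_map_closed[OF f] linear_map_closed[OF g]
  by (simp add: linear_map_add[OF f] linear_map_add[OF g] linear_map_smult[OF f]
      linear_map_smult[OF g] smult_r_distr M.a_ac)

lemma (in module) linear_map_diff:
  assumes f: "linear_map R V M f" and g: "linear_map R V M g"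
  shows "linear_map R V M (\<lambda>x. f x \<ominus>\<^bsub>M\<^esub> g x)"
  unfolding linear_map_def Pi_iff
  using linear_map_closed[OF f] linear_map_closed[OF g]
  by (simp add: linear_map_add[OF f] linear_map_add[OF g] linear_map_smult[OF f]
      linear_map_smult[OF g] smult_r_distr smult_r_minus a_minus_def M.minus_add M.a_ac)

lemma linear_map_id: "linear_map K V V (\<lambda>x. x)"
  unfolding linear_map_def by simp

section \<open>The center and the quotient by it\<close>

text \<open>The center algebra and the quotient are formed for records without further fields, so the
  type of \<open>L\<close> is specialized accordingly.\<close>

locale plain_lie_yamaguti = lie_yamaguti K L
  for K :: "('k, 'm) ring_scheme" and L :: "('k, 'v) ly_algebra" (structure)
begin

abbreviation Z where "Z \<equiv> ly_center L"
abbreviation p where "p \<equiv> ly_proj L"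
abbreviation Q where "Q \<equiv> ly_bar L"

lemma mult_closed: "a \<in> carrier L \<Longrightarrow> b \<in> carrier L \<Longrightarrow> a \<otimes> b \<in> carrier L"
  by (rule linear_map_closed[OF mult_linear_right])

lemma tri_closed:
  "a \<in> carrier L \<Longrightarrow> b \<in> carrier L \<Longrightarrow> c \<in> carrier L \<Longrightarrow> tri a b c \<in> carrier L"
  by (rule linear_map_closed[OF tri_linear_3])

lemma minus_zero_right: "x \<in> carrier L \<Longrightarrow> x \<ominus> \<zero> = x"
  using M.add.inv_one unfolding a_minus_def a_inv_def by simp

lemma linear_map_zero: "linear_map K L L f \<Longrightarrow> f \<zero> = \<zero>"
  by (rule linear_map_idempotent[OF M.abelian_group_axioms]) auto

lemma center_closed: "z \<in> Z \<Longrightarrow> z \<in> carrier L"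
  unfolding ly_center_def by blast

text \<open>The definition of the center puts the central element in one slot of the bracket and in the
  outer slots of the triple product; skew symmetry supplies the remaining slots.\<close>

lemma center_annihilates:
  assumes "z \<in> Z" "x \<in> carrier L" "y \<in> carrier L"
  shows "z \<otimes> x = \<zero>" "x \<otimes> z = \<zero>" "tri z x y = \<zero>" "tri x z y = \<zero>" "tri x y z = \<zero>"
proof -
  show "z \<otimes> x = \<zero>" "tri z x y = \<zero>" "tri x y z = \<zero>"
    using assms unfolding ly_center_def by auto
  then show "x \<otimes> z = \<zero>" "tri x z y = \<zero>"
    using LY1[of x z] LY2[of x z y] assms center_closed by auto
qed

lemma center_add:
  assumes "x \<in> Z" "y \<in> Z" shows "x \<oplus> y \<in> Z"
proof -
  have "x \<in> carrier L" "y \<in> carrier L" using assms center_closed by auto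
  then show ?thesis
    unfolding ly_center_def
    by (simp add: linear_map_add[OF mult_linear_left] linear_map_add[OF tri_linear_1]
        linear_map_add[OF tri_linear_3] center_annihilates[OF assms(1)]
        center_annihilates[OF assms(2)])
qed

lemma center_smult:
  assumes "k \<in> carrier K" "x \<in> Z" shows "k \<odot> x \<in> Z"
proof -
  have "x \<in> carrier L" using assms center_closed by auto
  with assms(1) show ?thesis
    unfolding ly_center_def
    by (simp add: linear_map_smult[OF mult_linear_left] linear_map_smult[OF tri_linear_1]
        linear_map_smult[OF tri_linear_3] center_annihilates[OF assms(2)] smult_r_null)
qed

lemma center_zero: "\<zero> \<in> Z"
  unfolding ly_center_def
  by (auto simp: linear_map_zero[OF mult_linear_left] linear_map_zero[OF tri_linear_1]
      linear_map_zero[OF tri_linear_3])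

lemma center_abelian_subgroup: "abelian_subgroup Z L"
proof (rule abelian_subgroupI3)
  show "additive_subgroup Z L"
  proof (unfold additive_subgroup_def, rule M.add.subgroupI)
    fix a assume "a \<in> Z"
    then have "\<ominus> a = (\<ominus>\<^bsub>K\<^esub> \<one>\<^bsub>K\<^esub>) \<odot> a"
      using smult_l_minus[of "\<one>\<^bsub>K\<^esub>" a] center_closed by simp
    then show "\<ominus> a \<in> Z" using center_smult[of "\<ominus>\<^bsub>K\<^esub> \<one>\<^bsub>K\<^esub>" a] \<open>a \<in> Z\<close> by simp
  qed (use center_closed center_zero center_add in auto)
qed (rule M.abelian_group_axioms)

sublocale center: abelian_subgroup Z L
  by (rule center_abelian_subgroup)

lemma proj_closed: "x \<in> carrier L \<Longrightarrow> p x \<in> carrier Q"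
  unfolding ly_proj_def ly_bar_def ly_quot_def A_RCOSETS_def' by auto

lemma proj_surj:
  assumes "A \<in> carrier Q" obtains x where "x \<in> carrier L" "p x = A"
  using assms unfolding ly_proj_def ly_bar_def ly_quot_def A_RCOSETS_def' by auto

lemma zero_bar: "p \<zero> = Z" "Z \<in> carrier Q"
proof -
  show "p \<zero> = Z" unfolding ly_proj_def
    using center.a_rcos_const[OF center_zero] by simp
  then show "Z \<in> carrier Q" using proj_closed[OF M.zero_closed] by simp
qed

lemma proj_center: "z \<in> Z \<Longrightarrow> p z = Z"
  unfolding ly_proj_def by (rule center.a_rcos_const)

lemma proj_add: "x \<in> carrier L \<Longrightarrow> y \<in> carrier L \<Longrightarrow> p (x \<oplus> y) = p x \<oplus>\<^bsub>Q\<^esub> p y"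
  unfolding ly_proj_def ly_bar_def ly_quot_def by (simp add: center.a_rcos_sum)

lemma proj_eqD:
  assumes "x \<in> carrier L" "y \<in> carrier L" "p x = p y"
  shows "x \<ominus> y \<in> Z"
  using assms center.a_rcos_module[of y x] center.a_rcos_self[of x] M.minus_closed
  unfolding ly_proj_def a_minus_def by auto

lemma proj_add_center: "x \<in> carrier L \<Longrightarrow> z \<in> Z \<Longrightarrow> p (x \<oplus> z) = p x"
  using proj_add[of x z] proj_add[of x \<zero>] proj_center[of z] zero_bar center_closed by auto

lemma proj_mem: "x \<in> carrier L \<Longrightarrow> y \<in> p x \<Longrightarrow> y \<in> carrier L \<and> p y = p x"
  unfolding ly_proj_def
  using center.a_repr_independence'[of y x] M.a_r_coset_subset_G[OF center.a_subset, of x] by auto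

lemma proj_self: "x \<in> carrier L \<Longrightarrow> x \<in> p x"
  unfolding ly_proj_def by (rule center.a_rcos_self)

lemma coset_subset: "A \<in> carrier Q \<Longrightarrow> a \<in> A \<Longrightarrow> a \<in> carrier L"
  using proj_surj proj_mem by metis

lemma coset_nonempty: "A \<in> carrier Q \<Longrightarrow> A \<noteq> {}"
  using proj_surj proj_self by (metis empty_iff)

lemma proj_smult:
  assumes k: "k \<in> carrier K" and x: "x \<in> carrier L"
  shows "p (k \<odot> x) = k \<odot>\<^bsub>Q\<^esub> p x"
proof -
  have "p (k \<odot> a) = p (k \<odot> x)" if "a \<in> p x" for a
  proof -
    have a: "a \<in> carrier L" "p a = p x" using proj_mem[OF x that] by auto
    then have "a \<ominus> x \<in> Z" using proj_eqD x by blast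
    then have "p (k \<odot> x \<oplus> k \<odot> (a \<ominus> x)) = p (k \<odot> x)"
      using k x by (intro proj_add_center center_smult) auto
    moreover have "k \<odot> x \<oplus> k \<odot> (a \<ominus> x) = k \<odot> a"
      using k x a by (metis M.a_comm M.add.inv_solve_right M.minus_closed a_minus_def smult_r_distr)
    ultimately show ?thesis by simp
  qed
  then have "(\<Union>a\<in>p x. p (k \<odot> a)) = p (k \<odot> x)" using proj_self[OF x] by blast
  then show ?thesis unfolding ly_bar_def ly_quot_def by (simp add: ly_proj_def)
qed

lemma proj_linear: "linear_map K L Q p"
  unfolding linear_map_def using proj_closed proj_add proj_smult by auto

lemma proj_diff_decompose:
  assumes "x \<in> carrier L" "y \<in> carrier L"
  shows "x = y \<oplus> (x \<ominus> y)"
  using assms by (simp add: a_minus_def M.a_lcomm[of y] M.r_neg)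

lemma linear_map_cong_proj:
  assumes f: "linear_map K L L f" and "\<And>z. z \<in> Z \<Longrightarrow> f z = \<zero>"
    and x: "x \<in> carrier L" "x' \<in> carrier L" and "p x = p x'"
  shows "f x = f x'"
proof -
  have z: "x \<ominus> x' \<in> Z" using assms proj_eqD by auto
  have "f x = f (x' \<oplus> (x \<ominus> x'))" using proj_diff_decompose[OF x] by simp
  also have "\<dots> = f x' \<oplus> \<zero>" using z x linear_map_add[OF f] assms(2) by simp
  finally show ?thesis using linear_map_closed[OF f x(2)] by simp
qed

text \<open>Arguments are replaced one at a time: with the others fixed, the operation is linear and kills
  the center.\<close>

lemma mult_cong_proj:
  assumes "x \<in> carrier L" "x' \<in> carrier L" "y \<in> carrier L" "y' \<in> carrier L"
    and "p x = p x'" "p y = p y'"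
  shows "x \<otimes> y = x' \<otimes> y'"
proof -
  have "x \<otimes> y = x' \<otimes> y"
    using assms by (intro linear_map_cong_proj[OF mult_linear_left]) (auto simp: center_annihilates)
  also have "\<dots> = x' \<otimes> y'"
    using assms by (intro linear_map_cong_proj[OF mult_linear_right]) (auto simp: center_annihilates)
  finally show ?thesis .
qed

lemma tri_cong_proj:
  assumes "x \<in> carrier L" "x' \<in> carrier L" "y \<in> carrier L" "y' \<in> carrier L"
    and "u \<in> carrier L" "u' \<in> carrier L" and "p x = p x'" "p y = p y'" "p u = p u'"
  shows "tri x y u = tri x' y' u'"
proof -
  have "tri x y u = tri x' y u"
    using assms by (intro linear_map_cong_proj[OF tri_linear_1]) (auto simp: center_annihilates)
  also have "\<dots> = tri x' y' u"
    using assms by (intro linear_map_cong_proj[OF tri_linear_2]) (auto simp: center_annihilates)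
  also have "\<dots> = tri x' y' u'"
    using assms by (intro linear_map_cong_proj[OF tri_linear_3]) (auto simp: center_annihilates)
  finally show ?thesis .
qed

end

section \<open>Nilpotency of index two\<close>

lemma lin_span_superset: "S \<subseteq> lin_span K V S"
  unfolding lin_span_def by blast

lemma zero_mem_lin_span: "\<zero>\<^bsub>V\<^esub> \<in> lin_span K V S"
  unfolding lin_span_def
  by (auto dest!: submodule.axioms(1) subgroup.one_closed)

lemma (in plain_lie_yamaguti) ly_series_SucI:
  assumes "a \<in> carrier L" "a \<in> ly_series K L n" "x \<in> carrier L" "y \<in> carrier L"
  shows "a \<otimes> x \<in> ly_series K L (Suc n)" "tri a x y \<in> ly_series K L (Suc n)"
    "tri x y a \<in> ly_series K L (Suc n)"
proof -
  have set_addI: "u \<oplus> v \<oplus> w \<in> U <+>\<^bsub>L\<^esub> V <+>\<^bsub>L\<^esub> W" if "u \<in> U" "v \<in> V" "w \<in> W" for u v w U V W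
    using that unfolding set_add_def' by blast
  let ?A = "lin_span K L {a \<otimes> x | a x. a \<in> ly_series K L n \<and> x \<in> carrier L}"
  let ?B = "lin_span K L {tri a x y | a x y.
              a \<in> ly_series K L n \<and> x \<in> carrier L \<and> y \<in> carrier L}"
  let ?C = "lin_span K L {tri x y a | x y a.
              x \<in> carrier L \<and> y \<in> carrier L \<and> a \<in> ly_series K L n}"
  have "a \<otimes> x \<in> ?A" "tri a x y \<in> ?B" "tri x y a \<in> ?C"
    using assms by (blast intro: subsetD[OF lin_span_superset])+
  note gen = this zero_mem_lin_span
  \<comment> \<open>A term of the series is a sum of three spans; a generator of one of them is padded with
    zeros from the other two.\<close>
  have "a \<otimes> x \<oplus> \<zero> \<oplus> \<zero> \<in> ly_series K L (Suc n)" "\<zero> \<oplus> tri a x y \<oplus> \<zero> \<in> ly_series K L (Suc n)"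
    "\<zero> \<oplus> \<zero> \<oplus> tri x y a \<in> ly_series K L (Suc n)"
    unfolding ly_series.simps by (intro set_addI gen)+
  then show "a \<otimes> x \<in> ly_series K L (Suc n)" "tri a x y \<in> ly_series K L (Suc n)"
    "tri x y a \<in> ly_series K L (Suc n)"
    using assms mult_closed tri_closed by simp_all
qed

locale lie_yamaguti_index_two = plain_lie_yamaguti K L
  for K :: "('k, 'm) ring_scheme" and L :: "('k, 'v) ly_algebra" (structure) +
  assumes index_two: "ly_nilpotent_of_index K L 2"
begin

text \<open>Multiplying an element of the first term of the series by arbitrary elements leads into the second
  term, which is zero.\<close>

lemma ly_series_one_subset_center:
  assumes "a \<in> carrier L" "a \<in> ly_series K L 1"
  shows "a \<in> Z"
proof -
  have "ly_series K L (Suc 1) = {\<zero>}"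
    using index_two unfolding ly_nilpotent_of_index_def by (simp add: numeral_2_eq_2)
  then show ?thesis
    unfolding ly_center_def using ly_series_SucI[OF assms] assms(1) by blast
qed

lemma mult_central: "a \<in> carrier L \<Longrightarrow> b \<in> carrier L \<Longrightarrow> a \<otimes> b \<in> Z"
  using ly_series_SucI(1)[of a 0 b b] mult_closed[of a b] ly_series_one_subset_center by simp

lemma tri_central:
  "a \<in> carrier L \<Longrightarrow> b \<in> carrier L \<Longrightarrow> c \<in> carrier L \<Longrightarrow> tri a b c \<in> Z"
  using ly_series_SucI(2)[of a 0 b c] tri_closed[of a b c] ly_series_one_subset_center by simp

lemma bar_mult:
  assumes "A \<in> carrier Q" "B \<in> carrier Q" shows "A \<otimes>\<^bsub>Q\<^esub> B = Z"
proof -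
  have "p (a \<otimes> b) = Z" if "a \<in> A" "b \<in> B" for a b
    by (intro proj_center mult_central coset_subset[OF assms(1)] coset_subset[OF assms(2)] that)
  then have "(\<Union>a\<in>A. \<Union>b\<in>B. p (a \<otimes> b)) = Z"
    using coset_nonempty[OF assms(1)] coset_nonempty[OF assms(2)] by auto
  then show ?thesis unfolding ly_bar_def ly_quot_def rcoset_mult_def by (simp add: ly_proj_def)
qed

lemma bar_tri:
  assumes "A \<in> carrier Q" "B \<in> carrier Q" "C \<in> carrier Q" shows "tri\<^bsub>Q\<^esub> A B C = Z"
proof -
  have "p (tri a b c) = Z" if "a \<in> A" "b \<in> B" "c \<in> C" for a b c
    by (intro proj_center tri_central coset_subset[OF assms(1)] coset_subset[OF assms(2)]
        coset_subset[OF assms(3)] that)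
  then have "(\<Union>a\<in>A. \<Union>b\<in>B. \<Union>c\<in>C. p (tri a b c)) = Z"
    using coset_nonempty[OF assms(1)] coset_nonempty[OF assms(2)] coset_nonempty[OF assms(3)]
    by auto
  then show ?thesis unfolding ly_bar_def ly_quot_def by (simp add: ly_proj_def)
qed

end

section \<open>The cocycle of a section\<close>

locale lie_yamaguti_section = lie_yamaguti_index_two K L
  for K :: "('k, 'm) ring_scheme" and L :: "('k, 'v) ly_algebra" (structure) +
  fixes s :: "'v set \<Rightarrow> 'v"
  assumes "section": "ly_section K L s"
begin

lemma section_linear: "linear_map K Q L s"
  using "section" unfolding ly_section_def by blast

lemma section_closed: "A \<in> carrier Q \<Longrightarrow> s A \<in> carrier L"
  by (rule linear_map_closed[OF section_linear])

lemma proj_section: "A \<in> carrier Q \<Longrightarrow> p (s A) = A"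
  using "section" unfolding ly_section_def by blast

lemma bar_zero_idempotent: "Z \<oplus>\<^bsub>Q\<^esub> Z = Z"
  using proj_add[of \<zero> \<zero>] zero_bar by simp

lemma section_zero: "s Z = \<zero>"
  by (rule linear_map_idempotent[OF M.abelian_group_axioms section_linear])
    (use zero_bar bar_zero_idempotent in auto)

lemma alpha_eq_mult:
  "A \<in> carrier Q \<Longrightarrow> B \<in> carrier Q \<Longrightarrow> ly_alpha L s A B = s A \<otimes> s B"
  unfolding ly_alpha_def
  by (simp add: bar_mult section_zero section_closed mult_closed minus_zero_right)

lemma beta_eq_tri:
  "A \<in> carrier Q \<Longrightarrow> B \<in> carrier Q \<Longrightarrow> C \<in> carrier Q \<Longrightarrow> ly_beta L s A B C = tri (s A) (s B) (s C)"
  unfolding ly_beta_def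
  by (simp add: bar_tri section_zero section_closed tri_closed minus_zero_right)

lemma center_part:
  assumes "x \<in> carrier L" shows "x \<ominus> s (p x) \<in> Z"
  using assms by (intro proj_eqD) (auto simp: section_closed proj_section proj_closed)

section \<open>Inducible pairs\<close>

text \<open>The products of section values are central, so \<open>\<gamma>\<close> acts on them as \<open>\<phi>\<close>; as \<open>\<gamma>\<close> is multiplicative
  and \<open>\<gamma> (s A)\<close>, \<open>s (\<psi> A)\<close> lie in one coset, the result is the product of the values
  \<open>s (\<psi> A)\<close>.\<close>

lemma inducible_imp_compatible:
  assumes \<psi>: "\<psi> \<in> ly_aut K Q" and ind: "ly_inducible K L s \<phi> \<psi>"
    and A: "A \<in> carrier Q" "B \<in> carrier Q" "C \<in> carrier Q"
  shows "\<phi> (ly_alpha L s A B) = ly_alpha L s (\<psi> A) (\<psi> B)"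
    and "\<phi> (ly_beta L s A B C) = ly_beta L s (\<psi> A) (\<psi> B) (\<psi> C)"
proof -
  obtain \<gamma> where \<gamma>: "\<gamma> \<in> ly_aut K L" and \<gamma>\<phi>: "\<And>z. z \<in> Z \<Longrightarrow> \<gamma> z = \<phi> z"
    and \<gamma>\<psi>: "\<And>A. A \<in> carrier Q \<Longrightarrow> p (\<gamma> (s A)) = \<psi> A"
    using ind unfolding ly_inducible_def by blast
  have \<psi>_closed: "\<psi> D \<in> carrier Q" if "D \<in> carrier Q" for D
    using that \<psi> unfolding ly_aut_def by (auto dest: linear_map_closed)
  have \<gamma>_closed: "\<gamma> x \<in> carrier L" if "x \<in> carrier L" for x
    using that \<gamma> unfolding ly_aut_def by (auto dest: linear_map_closed)
  have \<gamma>_mult: "\<gamma> (x \<otimes> y) = \<gamma> x \<otimes> \<gamma> y" if "x \<in> carrier L" "y \<in> carrier L" for x y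
    using that \<gamma> unfolding ly_aut_def by blast
  have \<gamma>_tri: "\<gamma> (tri x y u) = tri (\<gamma> x) (\<gamma> y) (\<gamma> u)"
    if "x \<in> carrier L" "y \<in> carrier L" "u \<in> carrier L" for x y u
    using that \<gamma> unfolding ly_aut_def by blast
  have same_coset: "p (\<gamma> (s D)) = p (s (\<psi> D))" if "D \<in> carrier Q" for D
    using that by (simp add: \<gamma>\<psi> proj_section \<psi>_closed)
  note closed = A section_closed \<psi>_closed \<gamma>_closed
  have "\<phi> (s A \<otimes> s B) = \<gamma> (s A) \<otimes> \<gamma> (s B)"
    using mult_central[of "s A" "s B"] by (simp add: \<gamma>\<phi>[symmetric] \<gamma>_mult \<gamma>_tri closed)
  also have "\<dots> = s (\<psi> A) \<otimes> s (\<psi> B)"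
    by (intro mult_cong_proj same_coset closed)
  finally show "\<phi> (ly_alpha L s A B) = ly_alpha L s (\<psi> A) (\<psi> B)"
    by (simp add: alpha_eq_mult closed)
  have "\<phi> (tri (s A) (s B) (s C)) = tri (\<gamma> (s A)) (\<gamma> (s B)) (\<gamma> (s C))"
    using tri_central[of "s A" "s B" "s C"] by (simp add: \<gamma>\<phi>[symmetric] \<gamma>_mult \<gamma>_tri closed)
  also have "\<dots> = tri (s (\<psi> A)) (s (\<psi> B)) (s (\<psi> C))"
    by (intro tri_cong_proj same_coset closed)
  finally show "\<phi> (ly_beta L s A B C) = ly_beta L s (\<psi> A) (\<psi> B) (\<psi> C)"
    by (simp add: beta_eq_tri closed)
qed

text \<open>The direct sum of \<open>\<psi>\<close>, transported to the image of \<open>s\<close>, and \<open>\<phi>\<close>, along the splitting of \<open>L\<close>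
  given by the section.\<close>

definition glue :: "('v \<Rightarrow> 'v) \<Rightarrow> ('v set \<Rightarrow> 'v set) \<Rightarrow> 'v \<Rightarrow> 'v" where
  "glue \<phi> \<psi> x = s (\<psi> (p x)) \<oplus> \<phi> (x \<ominus> s (p x))"

context
  fixes \<phi> :: "'v \<Rightarrow> 'v" and \<psi> :: "'v set \<Rightarrow> 'v set"
  assumes \<phi>: "\<phi> \<in> ly_aut K (ly_center_algebra L)" and \<psi>: "\<psi> \<in> ly_aut K (ly_bar L)"
begin

lemma \<phi>_bij: "bij_betw \<phi> Z Z"
  using \<phi> unfolding ly_aut_def ly_center_algebra_def by simp

lemma \<phi>_closed: "z \<in> Z \<Longrightarrow> \<phi> z \<in> Z"
  using \<phi>_bij unfolding bij_betw_def by blast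

lemma \<psi>_bij: "bij_betw \<psi> (carrier Q) (carrier Q)"
  using \<psi> unfolding ly_aut_def by simp

lemma \<psi>_closed: "A \<in> carrier Q \<Longrightarrow> \<psi> A \<in> carrier Q"
  using \<psi>_bij unfolding bij_betw_def by blast

lemma section_\<psi>_linear: "linear_map K Q L (\<lambda>A. s (\<psi> A))"
  using \<psi> unfolding ly_aut_def by (blast intro: linear_map_compose section_linear)

lemma glue_linear: "linear_map K L L (glue \<phi> \<psi>)"
proof -
  have sp: "linear_map K L L (\<lambda>x. x \<ominus> s (p x))"
    by (intro linear_map_diff linear_map_id linear_map_compose[OF proj_linear section_linear])
  have "linear_map K (ly_center_algebra L) (ly_center_algebra L) \<phi>"
    using \<phi> unfolding ly_aut_def by blast
  then have \<phi>': "linear_map K (ly_center_algebra L) L \<phi>"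
    unfolding linear_map_def ly_center_algebra_def by (auto intro: center_closed)
  have "linear_map K L (ly_center_algebra L) (\<lambda>x. x \<ominus> s (p x))"
    using sp center_part unfolding linear_map_def ly_center_algebra_def by auto
  from linear_map_compose[OF this \<phi>'] show ?thesis
    unfolding glue_def
    by (intro linear_map_plus linear_map_compose[OF proj_linear section_\<psi>_linear])
qed

lemma glue_closed: "x \<in> carrier L \<Longrightarrow> glue \<phi> \<psi> x \<in> carrier L"
  by (rule linear_map_closed[OF glue_linear])

lemma proj_glue:
  assumes "x \<in> carrier L" shows "p (glue \<phi> \<psi> x) = \<psi> (p x)"
  using assms unfolding glue_def
  by (simp add: proj_add_center section_closed proj_section \<psi>_closed proj_closed \<phi>_closed center_part)

lemma glue_center:
  assumes "z \<in> Z" shows "glue \<phi> \<psi> z = \<phi> z"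
proof -
  have "s (\<psi> Z) = \<zero>"
    by (rule linear_map_idempotent[OF M.abelian_group_axioms section_\<psi>_linear])
      (use zero_bar bar_zero_idempotent in auto)
  then show ?thesis
    using assms unfolding glue_def
    by (simp add: proj_center section_zero center_closed \<phi>_closed minus_zero_right)
qed

text \<open>The class \<open>p x\<close> is recovered from the image by \<open>proj_glue\<close> and injectivity of \<open>\<psi>\<close>; what remains
  is the central part, where \<open>\<phi>\<close> is injective. A preimage of \<open>y\<close> is assembled from preimages
  of its two parts.\<close>

lemma glue_bij: "bij_betw (glue \<phi> \<psi>) (carrier L) (carrier L)"
  unfolding bij_betw_def
proof
  show "inj_on (glue \<phi> \<psi>) (carrier L)"
  proof (rule inj_onI)
    fix x y assume x: "x \<in> carrier L" and y: "y \<in> carrier L" and eq: "glue \<phi> \<psi> x = glue \<phi> \<psi> y"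
    have "\<psi> (p x) = \<psi> (p y)" using eq proj_glue x y by metis
    then have pp: "p x = p y"
      using \<psi>_bij x y proj_closed unfolding bij_betw_def by (auto dest: inj_onD)
    have "\<phi> (x \<ominus> s (p x)) = \<phi> (y \<ominus> s (p y))"
      using eq x y center_closed[OF \<phi>_closed[OF center_part[OF x]]]
        center_closed[OF \<phi>_closed[OF center_part[OF y]]]
      unfolding glue_def pp by (simp add: section_closed \<psi>_closed proj_closed)
    then have "x \<ominus> s (p x) = y \<ominus> s (p y)"
      using \<phi>_bij x y center_part unfolding bij_betw_def by (auto dest: inj_onD)
    then show "x = y"
      using pp proj_diff_decompose x y section_closed proj_closed by metis
  qed
  show "glue \<phi> \<psi> ` carrier L = carrier L"
  proof
    show "carrier L \<subseteq> glue \<phi> \<psi> ` carrier L"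
    proof
      fix y assume y: "y \<in> carrier L"
      have "p y \<in> \<psi> ` carrier Q" "y \<ominus> s (p y) \<in> \<phi> ` Z"
        using \<psi>_bij \<phi>_bij proj_closed[OF y] center_part[OF y]
        by (simp_all only: bij_betw_imp_surj_on)
      then obtain A z where A: "A \<in> carrier Q" "\<psi> A = p y"
        and z: "z \<in> Z" "\<phi> z = y \<ominus> s (p y)"
        by (elim imageE) simp
      have cl: "s A \<in> carrier L" "z \<in> carrier L" using A z section_closed center_closed by auto
      then have pA: "p (s A \<oplus> z) = A" using A z by (simp add: proj_add_center proj_section)
      have "s A \<oplus> z \<ominus> s A = z"
        using cl by (simp add: a_minus_def M.a_comm[of "s A"] M.a_assoc M.r_neg)
      then have "glue \<phi> \<psi> (s A \<oplus> z) = s (p y) \<oplus> (y \<ominus> s (p y))"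
        unfolding glue_def pA A(2) z(2)[symmetric] by simp
      also have "\<dots> = y"
        by (rule proj_diff_decompose[OF y section_closed[OF proj_closed[OF y]], symmetric])
      finally have "glue \<phi> \<psi> (s A \<oplus> z) = y" .
      then show "y \<in> glue \<phi> \<psi> ` carrier L" using cl by force
    qed
  qed (use glue_closed in auto)
qed

text \<open>The arguments of a product may be replaced by the section values of their classes, where
  the product is a value of the cocycle; after applying \<open>\<phi>\<close>, the values \<open>s (\<psi> (p x))\<close> are replaced by
  \<open>glue \<phi> \<psi> x\<close>, which lies in the same coset.\<close>

lemma glue_automorphism:
  assumes \<alpha>: "\<And>A B. A \<in> carrier Q \<Longrightarrow> B \<in> carrier Q \<Longrightarrow>
      \<phi> (ly_alpha L s A B) = ly_alpha L s (\<psi> A) (\<psi> B)"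
    and \<beta>: "\<And>A B C. A \<in> carrier Q \<Longrightarrow> B \<in> carrier Q \<Longrightarrow> C \<in> carrier Q \<Longrightarrow>
      \<phi> (ly_beta L s A B C) = ly_beta L s (\<psi> A) (\<psi> B) (\<psi> C)"
  shows "glue \<phi> \<psi> \<in> ly_aut K L"
proof -
  have x_coset: "p x = p (s (p x))" if "x \<in> carrier L" for x
    using that by (simp add: proj_section proj_closed)
  have g_coset: "p (s (\<psi> (p x))) = p (glue \<phi> \<psi> x)" if "x \<in> carrier L" for x
    using that by (simp add: proj_section proj_closed \<psi>_closed proj_glue)
  note closed = section_closed proj_closed \<psi>_closed glue_closed
  have "glue \<phi> \<psi> (x \<otimes> y) = glue \<phi> \<psi> x \<otimes> glue \<phi> \<psi> y"
    if "x \<in> carrier L" "y \<in> carrier L" for x y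
  proof -
    have "glue \<phi> \<psi> (x \<otimes> y) = \<phi> (x \<otimes> y)"
      using that mult_central glue_center by blast
    also have "\<dots> = \<phi> (s (p x) \<otimes> s (p y))"
      using that by (intro arg_cong[of _ _ \<phi>] mult_cong_proj x_coset closed)
    also have "\<dots> = s (\<psi> (p x)) \<otimes> s (\<psi> (p y))"
      using \<alpha>[of "p x" "p y"] that by (simp add: alpha_eq_mult closed)
    also have "\<dots> = glue \<phi> \<psi> x \<otimes> glue \<phi> \<psi> y"
      using that by (intro mult_cong_proj g_coset closed)
    finally show ?thesis .
  qed
  moreover have "glue \<phi> \<psi> (tri x y u) = tri (glue \<phi> \<psi> x) (glue \<phi> \<psi> y) (glue \<phi> \<psi> u)"
    if "x \<in> carrier L" "y \<in> carrier L" "u \<in> carrier L" for x y u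
  proof -
    have "glue \<phi> \<psi> (tri x y u) = \<phi> (tri x y u)"
      using that tri_central glue_center by blast
    also have "\<dots> = \<phi> (tri (s (p x)) (s (p y)) (s (p u)))"
      using that by (intro arg_cong[of _ _ \<phi>] tri_cong_proj x_coset closed)
    also have "\<dots> = tri (s (\<psi> (p x))) (s (\<psi> (p y))) (s (\<psi> (p u)))"
      using \<beta>[of "p x" "p y" "p u"] that by (simp add: beta_eq_tri closed)
    also have "\<dots> = tri (glue \<phi> \<psi> x) (glue \<phi> \<psi> y) (glue \<phi> \<psi> u)"
      using that by (intro tri_cong_proj g_coset closed)
    finally show ?thesis .
  qed
  ultimately show ?thesis
    unfolding ly_aut_def using glue_linear glue_bij by blast
qed

lemma compatible_imp_inducible:
  assumes "\<And>A B. A \<in> carrier Q \<Longrightarrow> B \<in> carrier Q \<Longrightarrow>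
      \<phi> (ly_alpha L s A B) = ly_alpha L s (\<psi> A) (\<psi> B)"
    and "\<And>A B C. A \<in> carrier Q \<Longrightarrow> B \<in> carrier Q \<Longrightarrow> C \<in> carrier Q \<Longrightarrow>
      \<phi> (ly_beta L s A B C) = ly_beta L s (\<psi> A) (\<psi> B) (\<psi> C)"
  shows "ly_inducible K L s \<phi> \<psi>"
  unfolding ly_inducible_def
proof (intro bexI conjI ballI)
  show "glue \<phi> \<psi> \<in> ly_aut K L" using assms by (rule glue_automorphism)
  show "glue \<phi> \<psi> ` Z = Z"
    using \<phi>_bij glue_center unfolding bij_betw_def by (metis image_cong)
  show "p (glue \<phi> \<psi> (s A)) = \<psi> A" if "A \<in> carrier Q" for A
    using that by (simp add: proj_glue section_closed proj_section)
qed (rule glue_center)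

end

end

theorem lemma6p1:
  fixes K :: "('k, 'm) ring_scheme" and L :: "('k, 'v) ly_algebra"
    and s :: "'v set \<Rightarrow> 'v" and \<phi> :: "'v \<Rightarrow> 'v" and \<psi> :: "'v set \<Rightarrow> 'v set"
  assumes "lie_yamaguti K L"
    and "ly_nilpotent_of_index K L 2"
    and "ly_section K L s"
    and "\<phi> \<in> ly_aut K (ly_center_algebra L)"
    and "\<psi> \<in> ly_aut K (ly_bar L)"
  shows "ly_inducible K L s \<phi> \<psi> \<longleftrightarrow>
    (\<forall>a\<in>carrier (ly_bar L). \<forall>b\<in>carrier (ly_bar L). \<forall>c\<in>carrier (ly_bar L).
       \<phi> (ly_alpha L s a b) = ly_alpha L s (\<psi> a) (\<psi> b) \<and>
       \<phi> (ly_beta L s a b c) = ly_beta L s (\<psi> a) (\<psi> b) (\<psi> c))"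
proof -
  interpret lie_yamaguti_section K L s
    using assms(1-3)
    by (simp add: lie_yamaguti_section_def lie_yamaguti_section_axioms_def
        lie_yamaguti_index_two_def lie_yamaguti_index_two_axioms_def plain_lie_yamaguti_def)
  show ?thesis
  proof
    assume "ly_inducible K L s \<phi> \<psi>"
    then show "\<forall>a\<in>carrier (ly_bar L). \<forall>b\<in>carrier (ly_bar L). \<forall>c\<in>carrier (ly_bar L).
       \<phi> (ly_alpha L s a b) = ly_alpha L s (\<psi> a) (\<psi> b) \<and>
       \<phi> (ly_beta L s a b c) = ly_beta L s (\<psi> a) (\<psi> b) (\<psi> c)"
      using inducible_imp_compatible[OF assms(5)] by blast
  qed (use compatible_imp_inducible[OF assms(4,5)] in blast)
qed

end
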